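(* Let $b>0$, $c>0$, $\beta\ge 0$ be fixed. For $J\ge 2$ put $N=2^J-1$, $h=b/(N+1)=b/2^J$, $\delta=ch^{\beta}$ (with $\delta<b$), and let $A_J=A_\delta^h$ be the $N\times N$ nonlocal stiffness matrix. Let $0<\omega<1$ and $0<\eta\le 2\omega(1-\omega)$. Then for all sufficiently small $h$ (i.e. in the regime $h\to 0$), the damped Jacobi iteration matrix $K_J=I-\omega D_J^{-1}A_J$ satisfies $$\|K_J\nu\|_{A_J}^2\le \|\nu\|_{A_J}^2-\eta\,\|A_J\nu\|_{D_J^{-1}}^2\qquad\text{for all }\nu\in\mathbb{R}^N,$$ and the convergence factor of the two-grid method satisfies $$\|K_JT^J\|_{A_J}\le\sqrt{1-\eta/6}<1 .$$
   Context: **Stiffness matrix.** For $b>0$, $N\ge1$, $h=b/(N+1)$, $0<\delta<b$, set $R=\delta/h>0$ and $r=\lfloor R\rfloor$. The matrix $A_\delta^h\in\mathbb{R}^{N\times N}$ is the symmetric Toeplitz matrix with entries $a_{i,j}=a_{|i-j|}$, where $a_k=0$ for $k>r+1$ and: - If $R\le 1$: $a_0=2/h^2$, $a_1=-1/h^2$, and $a_k=0$ for $k\ge2$. - If $R>1$: $a_p=-\dfrac{3}{h^2R^3}$ for $1\le p\le r-1$; $a_r=-\dfrac{3r-1+(R-r)(r^2+rR-2R^2+3r+3R)}{2h^2R^3r}$; $a_{r+1}=-\dfrac{(R-r)(2R^2-rR-r^2)}{2h^2R^3(r+1)}$; $a_0=-2\sum_{p=1}^{r+1}a_p$. **Two-grid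 operators.** $D_J$ is the diagonal part of $A_J$. The restriction $I_J^{J-1}:\mathbb{R}^{2^J-1}\to\mathbb{R}^{2^{J-1}-1}$ is $(I_J^{J-1}\nu)_i=\frac14(\nu_{2i-1}+2\nu_{2i}+\nu_{2i+1})$, $i=1,\dots,2^{J-1}-1$; the prolongation is $I_{J-1}^J=2(I_J^{J-1})^T$. The coarse matrix is $A_{J-1}=I_J^{J-1}A_JI_{J-1}^J$, and the coarse-grid correction operator is $T^J=I-I_{J-1}^JA_{J-1}^{-1}I_J^{J-1}A_J$. **Norms.** For a symmetric positive definite matrix $M$, $\|\nu\|_M=(M\nu,\nu)^{1/2}$ with the Euclidean inner product, and for a matrix $B$, $\|B\|_M=\sup_{\nu\ne0}\|B\nu\|_M/\|\nu\|_M$. (The matrix $A_J$ is symmetric positive definite.) *)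

theory Defs
  imports Complex_Main "Jordan_Normal_Form.Gauss_Jordan_Elimination"
begin

text \<open>
  The matrix dimensions depend on the level \<open>J\<close>, so vectors and matrices are those of
  \<open>Jordan_Normal_Form\<close>. Their indices start at \<open>0\<close>: position \<open>i\<close> here
  is position \<open>i + 1\<close> in the usual one-based numbering.
\<close>

text \<open>Intended for \<open>p \<ge> 1\<close> only; the value at \<open>p = 0\<close> is irrelevant.\<close>

definition toeplitz_offdiag :: "real \<Rightarrow> real \<Rightarrow> nat \<Rightarrow> real" where
  "toeplitz_offdiag h R p =
    (let m = nat \<lfloor>R\<rfloor>; r = real m in
      if R \<le> 1 then (if p = 1 then - 1 / h^2 else 0)
      else if p < m then - 3 / (h^2 * R^3)
      else if p = m then
        - ((3 * r - 1 + (R - r) * (r^2 + r * R - 2 * R^2 + 3 * r + 3 * R)) / (2 * h^2 * R^3 * r))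
      else if p = m + 1 then
        - (((R - r) * (2 * R^2 - r * R - r^2)) / (2 * h^2 * R^3 * (r + 1)))
      else 0)"

definition toeplitz_coeff :: "real \<Rightarrow> real \<Rightarrow> nat \<Rightarrow> real" where
  "toeplitz_coeff h R k =
    (if k = 0 then
       (if R \<le> 1 then 2 / h^2 else - 2 * (\<Sum>p = 1..nat \<lfloor>R\<rfloor> + 1. toeplitz_offdiag h R p))
     else toeplitz_offdiag h R k)"

definition stiffness_mat :: "real \<Rightarrow> nat \<Rightarrow> real \<Rightarrow> real mat" where
  "stiffness_mat b N \<delta> =
    (let h = b / (real N + 1) in
      mat N N (\<lambda>(i, j). toeplitz_coeff h (\<delta> / h) (nat \<bar>int i - int j\<bar>)))"

definition diag_part :: "real mat \<Rightarrow> real mat" where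
  "diag_part A = mat_diag (dim_row A) (\<lambda>i. A $$ (i, i))"

text \<open>The inverse matrix; meaningful only when \<open>A\<close> is invertible.\<close>

definition mat_inv :: "real mat \<Rightarrow> real mat" where
  "mat_inv A = the (mat_inverse A)"

definition restriction :: "nat \<Rightarrow> real mat" where
  "restriction J = mat (2^(J-1) - 1) (2^J - 1)
    (\<lambda>(i, j). if j = 2 * i \<or> j = 2 * i + 2 then 1 / 4 else if j = 2 * i + 1 then 1 / 2 else 0)"

definition prolongation :: "nat \<Rightarrow> real mat" where
  "prolongation J = 2 \<cdot>\<^sub>m transpose_mat (restriction J)"

definition coarse_mat :: "nat \<Rightarrow> real mat \<Rightarrow> real mat" where
  "coarse_mat J A = restriction J * A * prolongation J"

definition coarse_correction :: "nat \<Rightarrow> real mat \<Rightarrow> real mat" where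
  "coarse_correction J A =
    1\<^sub>m (2^J - 1) - prolongation J * mat_inv (coarse_mat J A) * restriction J * A"

definition damped_jacobi :: "real \<Rightarrow> real mat \<Rightarrow> real mat" where
  "damped_jacobi \<omega> A = 1\<^sub>m (dim_row A) - \<omega> \<cdot>\<^sub>m (mat_inv (diag_part A) * A)"

definition vnorm :: "real mat \<Rightarrow> real vec \<Rightarrow> real" where
  "vnorm M v = sqrt ((M *\<^sub>v v) \<bullet> v)"

definition opnorm :: "real mat \<Rightarrow> real mat \<Rightarrow> real" where
  "opnorm M B =
    (SUP v \<in> carrier_vec (dim_row M) - {0\<^sub>v (dim_row M)}. vnorm M (B *\<^sub>v v) / vnorm M v)"

end

theory Submission
  imports Defs "Jordan_Normal_Form.Determinant" "HOL-Library.Groups_Big_Fun"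
begin

text \<open>
  Extend a grid vector by zero to a sequence \<open>f\<close> on the integers and put
  \<open>S\<^sub>p = (\<Sum>i. (f (i + p) - f i)\<^sup>2)\<close>. The off-diagonal entries are \<open>- w\<^sub>p\<close> with \<open>w\<^sub>p \<ge> 0\<close> and
  \<open>a\<^sub>0 = 2 (\<Sum>p. w\<^sub>p)\<close>, so \<open>(A \<nu>, \<nu>) = (\<Sum>p. w\<^sub>p S\<^sub>p)\<close>. From \<open>S\<^sub>p \<le> 4 \<parallel>\<nu>\<parallel>\<^sup>2\<close> one gets
  \<open>A \<le> 2 a\<^sub>0\<close>, which is the smoothing property of the damped Jacobi iteration.

  For the approximation property, interpolate linearly from the coarse grid points: the error
  satisfies \<open>\<parallel>\<nu> - P w\<parallel>\<^sup>2 \<le> S\<^sub>1 / 2\<close>. The triangle inequality gives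
  \<open>S\<^sub>1 \<le> 2 S\<^sub>p + 2 S\<^sub>p\<^sub>+\<^sub>1\<close>, and summing this over pairs of neighbouring lags yields
  \<open>a\<^sub>0 S\<^sub>1 / 2 \<le> 6 (A \<nu>, \<nu>)\<close>, uniformly in \<open>R > 0\<close>. The constant \<open>6\<close> is the one in the
  convergence factor, by the standard argument combining Galerkin orthogonality with smoothing.
\<close>

section \<open>Lag energies of sequences with finite support\<close>

(* The notation of Groups_Big_Fun clashes with that of infinite series. *)
no_notation suminf (binder "\<Sum>" 10)

text \<open>The autocorrelation of \<open>f\<close>. Summing over all integers frees shifts from
  boundary terms. \<open>Sum_any\<close> has the value \<open>0\<close> on infinite support, which
  is why finiteness has to be tracked below.\<close>

definition lag_product :: "(int \<Rightarrow> real) \<Rightarrow> int \<Rightarrow> real" where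
  "lag_product f k = (\<Sum>i. f i * f (i + k))"

definition lag_energy :: "(int \<Rightarrow> real) \<Rightarrow> int \<Rightarrow> real" where
  "lag_energy f k = (\<Sum>i. (f (i + k) - f i)^2)"

lemma Sum_any_shift: "(\<Sum>i. g (i + k)) = (\<Sum>i. g i)" for g :: "int \<Rightarrow> 'a::comm_monoid_add"
proof -
  have "bij (\<lambda>i. i + k)"
    by (rule bij_betw_byWitness[where f' = "\<lambda>i. i - k"]) auto
  then show ?thesis
    by (rule Sum_any.reindex_cong[symmetric]) auto
qed

lemma finite_support_shift:
  fixes f :: "int \<Rightarrow> 'a::zero"
  assumes "finite {i. f i \<noteq> 0}"
  shows "finite {i. f (i + k) \<noteq> 0}"
proof -
  have "{i. f (i + k) \<noteq> 0} = (\<lambda>i. i - k) ` {i. f i \<noteq> 0}"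
    by (auto simp: image_iff) (metis add_diff_cancel)
  then show ?thesis using assms by simp
qed

lemma Sum_any_mono:
  fixes g h :: "'a \<Rightarrow> real"
  assumes "finite {i. g i \<noteq> 0}" "finite {i. h i \<noteq> 0}" "\<And>i. g i \<le> h i"
  shows "Sum_any g \<le> Sum_any h"
proof -
  let ?F = "{i. g i \<noteq> 0} \<union> {i. h i \<noteq> 0}"
  have "Sum_any g = sum g ?F" "Sum_any h = sum h ?F"
    using assms by (auto intro!: Sum_any.expand_superset)
  then show ?thesis using assms(3) by (simp add: sum_mono)
qed

context
  fixes f :: "int \<Rightarrow> real"
  assumes fin: "finite {i. f i \<noteq> 0}"
begin

text \<open>Most summands below are functions of two shifted values that vanish at
  \<open>(0, 0)\<close>; this settles their finiteness conditions at once.\<close>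

lemma finite_support_comb:
  assumes "\<phi> 0 0 = (0::real)"
  shows "finite {i. \<phi> (f (i + k)) (f (i + l)) \<noteq> 0}"
  by (rule finite_subset[OF _ finite_UnI[OF finite_support_shift[OF fin, of k]
        finite_support_shift[OF fin, of l]]]) (use assms in auto)

text \<open>Expanding the square leaves a cross term and two sums of squares, which agree by shift
  invariance.\<close>

lemma lag_energy_eq: "lag_energy f k = 2 * lag_product f 0 - 2 * lag_product f k"
proof -
  have 1: "finite {i. f (i + l) * f (i + k) \<noteq> 0}" for k l
    by (rule finite_support_comb[where \<phi> = "\<lambda>x y. x * y"]) simp
  have 2: "finite {i. - 2 * (f i * f (i + k)) \<noteq> 0}"
    using finite_support_comb[where \<phi> = "\<lambda>x y. - 2 * (x * y)" and k = 0 and l = k] by simp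
  have 3: "finite {i. f i * f i + - 2 * (f i * f (i + k)) \<noteq> 0}"
    using finite_support_comb[where \<phi> = "\<lambda>x y. x * x + - 2 * (x * y)" and k = 0 and l = k] by simp
  have "lag_energy f k = (\<Sum>i. f (i + k) * f (i + k) + (f i * f i + - 2 * (f i * f (i + k))))"
    unfolding lag_energy_def by (intro Sum_any.cong) (simp add: power2_eq_square algebra_simps)
  also have "\<dots> = (\<Sum>i. f (i + k) * f (i + k)) + ((\<Sum>i. f i * f i) + (\<Sum>i. - 2 * (f i * f (i + k))))"
    using 1[of k k] 1[of 0 0] 2 3 by (simp only: Sum_any.distrib add_0_right)
  also have "(\<Sum>i. f (i + k) * f (i + k)) = (\<Sum>i. f i * f i)"
    by (rule Sum_any_shift[of "\<lambda>i. f i * f i"])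
  also have "(\<Sum>i. - 2 * (f i * f (i + k))) = - 2 * lag_product f k"
    unfolding lag_product_def using 1[of 0 k] by (intro Sum_any_right_distrib[symmetric]) simp
  finally show ?thesis by (simp add: lag_product_def)
qed

lemma lag_product_minus: "lag_product f (- k) = lag_product f k"
  using Sum_any_shift[of "\<lambda>i. f i * f (i - k)" k] by (simp add: lag_product_def mult.commute)

lemma lag_energy_nonneg: "0 \<le> lag_energy f k"
  unfolding lag_energy_def Sum_any.expand_set by (simp add: sum_nonneg)

text \<open>Sum \<open>(x - y)^2 \<le> 2 * x^2 + 2 * y^2\<close> and shift. The factor
  \<open>4\<close> is what bounds the matrix by twice its diagonal entry.\<close>

lemma lag_energy_le: "lag_energy f k \<le> 4 * lag_product f 0"
proof -
  have 1: "finite {i. (f (i + k) - f (i + 0))^2 \<noteq> 0}"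
    by (rule finite_support_comb[where \<phi> = "\<lambda>x y. (x - y)^2"]) simp
  have 2: "finite {i. c * f (i + k)^2 \<noteq> 0}" for k c
    by (rule finite_support_comb[where \<phi> = "\<lambda>x y. c * x^2"]) simp
  have 3: "finite {i. 2 * f (i + k)^2 + 2 * f (i + 0)^2 \<noteq> 0}"
    by (rule finite_support_comb[where \<phi> = "\<lambda>x y. 2 * x^2 + 2 * y^2"]) simp
  have "lag_energy f k \<le> (\<Sum>i. 2 * f (i + k)^2 + 2 * f (i + 0)^2)"
    unfolding lag_energy_def
  proof (rule Sum_any_mono)
    show "(f (i + k) - f i)\<^sup>2 \<le> 2 * (f (i + k))\<^sup>2 + 2 * (f (i + 0))\<^sup>2" for i
      using zero_le_power2[of "f (i + k) + f i"] by (simp add: power2_eq_square algebra_simps)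
  qed (use 1 3 in simp_all)
  also have "\<dots> = (\<Sum>i. 2 * f (i + k)^2) + (\<Sum>i. 2 * f (i + 0)^2)"
    by (rule Sum_any.distrib) (rule 2)+
  also have "\<dots> = 4 * lag_product f 0"
    using Sum_any_shift[of "\<lambda>i. 2 * f i^2" k] 2[of 1 0]
    by (simp add: lag_product_def power2_eq_square Sum_any_right_distrib)
  finally show ?thesis .
qed

text \<open>A unit step is the difference of two overlapping jumps of lengths \<open>k + 1\<close> and \<open>k\<close>.\<close>

lemma lag_energy_1_le: "lag_energy f 1 \<le> 2 * lag_energy f k + 2 * lag_energy f (k + 1)"
proof -
  let ?x = "\<lambda>i. (f (i + 1 + k) - f (i + 1))^2" and ?y = "\<lambda>i. (f (i + (k + 1)) - f i)^2"
  have x: "finite {i. c * ?x i \<noteq> 0}" for c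
    using finite_support_comb[where \<phi> = "\<lambda>x y. c * (x - y)^2" and k = "1 + k" and l = 1] 
    by (simp add: add.assoc)
  have y: "finite {i. c * ?y i \<noteq> 0}" for c
    using finite_support_comb[where \<phi> = "\<lambda>x y. c * (x - y)^2" and k = "k + 1" and l = 0] by simp
  have xy: "finite {i. 2 * ?x i + 2 * ?y i \<noteq> 0}"
    by (rule finite_subset[OF _ finite_UnI[OF x[of 1] y[of 1]]]) auto
  have "lag_energy f 1 \<le> (\<Sum>i. 2 * ?x i + 2 * ?y i)"
    unfolding lag_energy_def
  proof (rule Sum_any_mono)
    show "finite {i. (f (i + 1) - f i)\<^sup>2 \<noteq> 0}"
      using finite_support_comb[where \<phi> = "\<lambda>x y. (x - y)^2" and k = 1 and l = 0] by simp
    fix i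
    have "(f (i + 1) - f i)\<^sup>2 = (f (i + (k + 1)) - f i - (f (i + 1 + k) - f (i + 1)))\<^sup>2"
      by (simp add: algebra_simps)
    also have "\<dots> \<le> 2 * ?x i + 2 * ?y i"
      using zero_le_power2[of "f (i + (k + 1)) - f i + (f (i + 1 + k) - f (i + 1))"]
      by (simp add: power2_eq_square algebra_simps)
    finally show "(f (i + 1) - f i)\<^sup>2 \<le> 2 * ?x i + 2 * ?y i" .
  qed (rule xy)
  also have "\<dots> = 2 * Sum_any ?x + 2 * Sum_any ?y"
    using x[of 1] y[of 1] by (simp only: Sum_any.distrib[OF x y] mult_1 Sum_any_right_distrib)
  also have "Sum_any ?x = lag_energy f k"
    unfolding lag_energy_def by (rule Sum_any_shift[of "\<lambda>i. (f (i + k) - f i)^2"])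
  finally show ?thesis by (simp add: lag_energy_def)
qed

end

section \<open>The weights of the stiffness matrix\<close>

text \<open>Among \<open>n\<close> consecutive terms there are at least \<open>(n - 1) / 2\<close>
  disjoint neighbouring pairs, each of sum at least \<open>t / 2\<close>. Hence the induction in
  steps of two; the \<open>- 1\<close> pays for an unpaired term.\<close>

lemma sum_consecutive_ge:
  fixes S :: "nat \<Rightarrow> real"
  assumes "\<And>p. 0 \<le> S p" "\<And>p. t \<le> 2 * S p + 2 * S (p + 1)" "0 \<le> t"
  shows "(real n - 1) / 4 * t \<le> (\<Sum>p = k..<k + n. S p)"
proof (induction n rule: induct_nat_012)
  case (ge2 n)
  have "(\<Sum>p = k..<k + Suc (Suc n). S p) = (\<Sum>p = k..<k + n. S p) + (S (k + n) + S (k + n + 1))"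
    by simp
  then show ?case using ge2(1) assms(2)[of "k + n"] by (simp add: field_simps)
qed (use assms in auto)

text \<open>The sign is flipped so that these are the non-negative edge weights of a graph
  Laplacian, the coefficients of the lag energies in the quadratic form.\<close>

definition edge_weight :: "real \<Rightarrow> real \<Rightarrow> nat \<Rightarrow> real" where
  "edge_weight h R p = - toeplitz_offdiag h R p"

text \<open>With \<open>r = \<lfloor>R\<rfloor>\<close> and \<open>s = R - r\<close> the last two numerators become
  \<open>3 r - 1 + 3 r s (2 - s) + s\<^sup>2 (3 - 2 s)\<close> and \<open>s\<^sup>2 (3 r + 2 s)\<close>.\<close>

lemma edge_weight_bounds:
  fixes h R :: real
  defines "m \<equiv> nat \<lfloor>R\<rfloor>" and "\<kappa> \<equiv> 1 / (h^2 * R^3)"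
  assumes "h > 0" "R > 1"
  shows "p < m \<Longrightarrow> edge_weight h R p = 3 * \<kappa>"
    and "0 \<le> edge_weight h R m" "edge_weight h R m \<le> 3 * \<kappa>"
    and "0 \<le> edge_weight h R (m + 1)" "edge_weight h R (m + 1) \<le> 3 / 2 * \<kappa>"
    and "m = 1 \<Longrightarrow> \<kappa> \<le> edge_weight h R m"
proof -
  define r s where "r = real m" and "s = R - r"
  have m: "m \<ge> 1" using assms by (simp add: m_def le_nat_floor)
  then have r: "r \<ge> 1" by (simp add: r_def)
  have s: "0 \<le> s" "s \<le> 1" and R: "R = r + s"
    using assms unfolding s_def r_def m_def by linarith+
  have \<kappa>: "\<kappa> > 0" using assms by (simp add: \<kappa>_def)
  define num where "num = 3 * r - 1 + (R - r) * (r^2 + r * R - 2 * R^2 + 3 * r + 3 * R)"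
  have num1: "num = (3 * r - 1) + 3 * r * s * (2 - s) + s^2 * (3 - 2 * s)"
    unfolding num_def R by (simp add: power2_eq_square algebra_simps)
  \<comment> \<open>The gap to \<open>6 * r\<close> has a double zero at \<open>s = 1\<close>, where
    lag \<open>m\<close> reaches the bulk weight \<open>3 * \<kappa>\<close>; in factored form its
    sign is visible.\<close>
  have num2: "6 * r - num = (1 - s)^2 * (3 * r + 1 + 2 * s)"
    unfolding num_def R by (simp add: power2_eq_square algebra_simps)
  have num0: "3 * r - 1 \<le> num" unfolding num1 using r s by simp
  have num6: "num \<le> 6 * r"
  proof -
    have "0 \<le> (1 - s)^2 * (3 * r + 1 + 2 * s)" using r s by (intro mult_nonneg_nonneg) auto
    then show ?thesis using num2 by linarith
  qed
  have wm: "edge_weight h R m = \<kappa> * (num / (2 * r))"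
    using assms(3,4) by (simp add: edge_weight_def toeplitz_offdiag_def Let_def num_def r_def 
        \<kappa>_def flip: m_def)
  define num' where "num' = (R - r) * (2 * R^2 - r * R - r^2)"
  have num'_eq: "num' = s^2 * (3 * r + 2 * s)"
    unfolding num'_def R by (simp add: power2_eq_square algebra_simps)
  have wm1: "edge_weight h R (m + 1) = \<kappa> * (num' / (2 * (r + 1)))"
    using assms(3,4) by (simp add: edge_weight_def toeplitz_offdiag_def Let_def num'_def r_def 
        \<kappa>_def flip: m_def)
  have num'0: "0 \<le> num'" unfolding num'_eq using r s by simp
  have "s^2 * (3 * r + 2 * s) \<le> 1 * (3 * r + 2 * s)"
    using r s by (intro mult_right_mono) (auto simp: power_le_one)
  then have num'3: "num' \<le> 3 * (r + 1)" unfolding num'_eq using s by simp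
  show "p < m \<Longrightarrow> edge_weight h R p = 3 * \<kappa>"
    using assms(3,4) by (simp add: edge_weight_def toeplitz_offdiag_def Let_def \<kappa>_def flip: m_def)
  show "0 \<le> edge_weight h R m" unfolding wm using \<kappa> num0 r by simp
  have "num / (2 * r) \<le> 3" using num6 r by (simp add: field_simps)
  then show "edge_weight h R m \<le> 3 * \<kappa>" 
    unfolding wm using mult_left_mono[of "num / (2 * r)" 3 \<kappa>] \<kappa> by (simp only: mult.commute less_imp_le)
  show "0 \<le> edge_weight h R (m + 1)" unfolding wm1 using \<kappa> num'0 r by simp
  have "num' / (2 * (r + 1)) \<le> 3 / 2" using num'3 r by (simp add: field_simps)
  then show "edge_weight h R (m + 1) \<le> 3 / 2 * \<kappa>" 
    unfolding wm1 using mult_left_mono[of "num' / (2 * (r + 1))" "3 / 2" \<kappa>] \<kappa> 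
    by (simp only: mult.commute less_imp_le)
  \<comment> \<open>For \<open>r = 1\<close> the lower bound \<open>3 * r - 1\<close> on
    \<open>num\<close> equals the denominator \<open>2 * r\<close>.\<close>
  show "\<kappa> \<le> edge_weight h R m" if "m = 1"
  proof -
    have "r = 1" using that by (simp add: r_def)
    then show ?thesis 
      unfolding wm using mult_left_mono[of 1 "num / (2 * r)" \<kappa>] \<kappa> num0 by simp
  qed
qed

lemma edge_weight_nonneg:
  assumes "h > 0" "R > 0" "p \<ge> 1"
  shows "0 \<le> edge_weight h R p"
proof (cases "R \<le> 1")
  case True
  then show ?thesis by (simp add: edge_weight_def toeplitz_offdiag_def)
next
  case False
  define m where "m = nat \<lfloor>R\<rfloor>"
  consider "p < m" | "p = m" | "p = m + 1" | "p > m + 1" by linarith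
  then show ?thesis
    using edge_weight_bounds[of h R] assms False
    by cases (auto simp: m_def, simp add: edge_weight_def toeplitz_offdiag_def Let_def)
qed

text \<open>This makes the quadratic form definite. Lag \<open>1\<close> has the bulk weight when
  the floor of \<open>R\<close> exceeds \<open>1\<close>; when the floor is \<open>1\<close> and
  \<open>R > 1\<close>, the last bound of \<open>edge_weight_bounds\<close> applies.\<close>

lemma edge_weight_1_pos:
  assumes "h > 0" "R > 0"
  shows "0 < edge_weight h R 1"
proof (cases "R \<le> 1")
  case True
  then show ?thesis using assms by (simp add: edge_weight_def toeplitz_offdiag_def)
next
  case False
  then have R: "R > 1" and "nat \<lfloor>R\<rfloor> \<ge> 1" by (simp_all add: le_nat_floor)
  then consider "1 < nat \<lfloor>R\<rfloor>" | "nat \<lfloor>R\<rfloor> = 1" by linarith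
  moreover have pos: "0 < 1 / (h^2 * R^3)" using assms by simp
  ultimately have "1 / (h^2 * R^3) \<le> edge_weight h R 1"
    using edge_weight_bounds(1,6)[OF assms(1) R] by cases (simp only:, auto)
  with pos show ?thesis by linarith
qed

text \<open>The lags \<open>2, \<dots>, m - 1\<close> carry equal weights, so grouping them in consecutive pairs
  recovers all but a bounded part of the total weight; lag \<open>1\<close> itself absorbs the rest.\<close>

lemma edge_weight_comparison:
  fixes S :: "nat \<Rightarrow> real"
  assumes h: "h > 0" and R: "R > 0"
    and S: "\<And>p. 0 \<le> S p" "\<And>p. S 1 \<le> 2 * S p + 2 * S (p + 1)"
  defines "m \<equiv> nat \<lfloor>R\<rfloor>"
  shows "(\<Sum>p = 1..m + 1. edge_weight h R p) * S 1 \<le> 6 * (\<Sum>p = 1..m + 1. edge_weight h R p * S p)"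
proof (cases "R \<le> 1 \<or> m = 1")
  case True
  have nn: "0 \<le> edge_weight h R p" if "p \<ge> 1" for p
    using edge_weight_nonneg h R that by simp
  \<comment> \<open>Only lags \<open>1\<close> and \<open>2\<close> can have non-zero weight here.
    If \<open>R > 1\<close> and \<open>m = 1\<close>, the first weight is at least
    \<open>1 / (h^2 * R^3)\<close> and the second at most \<open>3 / 2\<close> times that, so the
    total is at most \<open>5 / 2\<close> times the first.\<close>
  have "(\<Sum>p = 1..m + 1. edge_weight h R p) \<le> 6 * edge_weight h R 1"
  proof (cases "R \<le> 1")
    case True
    have "edge_weight h R p = 0" if "p > 1" for p
      using True that by (simp add: edge_weight_def toeplitz_offdiag_def)
    then have "(\<Sum>p = 1..m + 1. edge_weight h R p) = (\<Sum>p = 1..1. edge_weight h R p)"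
      by (intro sum.mono_neutral_right) auto
    then show ?thesis using nn[of 1] by simp
  next
    case False
    then have R1: "R > 1" by simp
    have "m = 1" using False True by simp
    then have "(\<Sum>p = 1..m + 1. edge_weight h R p) = edge_weight h R 1 + edge_weight h R 2"
      by (simp add: numeral_2_eq_2)
    moreover have "0 < 1 / (h^2 * R^3)" using assms by simp
    ultimately show ?thesis 
      using edge_weight_bounds(5,6)[OF h R1, folded m_def] \<open>m = 1\<close> 
      by (simp only: one_add_one) linarith
  qed
  then have "(\<Sum>p = 1..m + 1. edge_weight h R p) * S 1 \<le> 6 * (edge_weight h R 1 * S 1)"
    using mult_right_mono[OF _ S(1)[of 1]] by (metis mult.assoc)
  also have "edge_weight h R 1 * S 1 \<le> (\<Sum>p = 1..m + 1. edge_weight h R p * S p)"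
    using nn S(1) by (intro member_le_sum) auto
  finally show ?thesis by simp
next
  case False
  define \<kappa> where "\<kappa> = 1 / (h^2 * R^3)"
  have \<kappa>: "\<kappa> > 0" using h R by (simp add: \<kappa>_def)
  have "m \<ge> 1" using False by (simp add: m_def le_nat_floor)
  with False have m: "m \<ge> 2" by linarith
  note w = edge_weight_bounds[OF h, of R, folded m_def \<kappa>_def]
  \<comment> \<open>The half-open range consists of the lags \<open>2, ..., m - 1\<close> and is
    empty for \<open>m = 2\<close>.\<close>
  have split: "{1..m + 1} = {1, m, m + 1} \<union> {2..<2 + (m - 2)}" using m by auto
  have sumsplit: "(\<Sum>p = 1..m + 1. g p) = g 1 + g m + g (m + 1) + (\<Sum>p = 2..<2 + (m - 2). g p)"
    for g :: "nat \<Rightarrow> real"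
    unfolding split by (subst sum.union_disjoint) (use m in auto)
  have S3: "(real (m - 2) - 1) / 4 * S 1 \<le> (\<Sum>p = 2..<2 + (m - 2). S p)"
    using S by (intro sum_consecutive_ge) auto
  \<comment> \<open>The first \<open>m\<close> lags weigh at most \<open>3 * \<kappa>\<close> each,
    the last one at most half of that.\<close>
  have "(\<Sum>p = 1..m + 1. edge_weight h R p) \<le> 3 * \<kappa> * real m + 3 / 2 * \<kappa>"
  proof -
    have "(\<Sum>p = 2..<2 + (m - 2). edge_weight h R p) = (\<Sum>p = 2..<2 + (m - 2). 3 * \<kappa>)"
      using w(1) False m by (intro sum.cong) auto
    also have "\<dots> = 3 * \<kappa> * real m - 6 * \<kappa>" using m by (simp add: of_nat_diff algebra_simps)
    finally have "(\<Sum>p = 2..<2 + (m - 2). edge_weight h R p) = 3 * \<kappa> * real m - 6 * \<kappa>" .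
    then show ?thesis unfolding sumsplit using w(1)[of 1] w(3,5) False m by simp
  qed
  then have "(\<Sum>p = 1..m + 1. edge_weight h R p) * S 1 \<le> (3 * \<kappa> * real m + 3 / 2 * \<kappa>) * S 1"
    using S(1) by (rule mult_right_mono)
  \<comment> \<open>The right-hand side equals \<open>9 / 2 * \<kappa> * (m + 1) * S 1\<close>,
    which exceeds the left-hand side in both coefficients.\<close>
  also have "\<dots> \<le> 6 * (3 * \<kappa> * (S 1 + (real (m - 2) - 1) / 4 * S 1))"
  proof -
    have "0 \<le> \<kappa> * S 1 * real m" "0 \<le> \<kappa> * S 1" using \<kappa> S(1) by auto
    then show ?thesis using m by (simp add: field_simps of_nat_diff)
  qed
  also have "\<dots> \<le> 6 * (3 * \<kappa> * (S 1 + (\<Sum>p = 2..<2 + (m - 2). S p)))"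
    using S3 \<kappa> by simp
  \<comment> \<open>The lags \<open>m\<close> and \<open>m + 1\<close> are dropped, by
    non-negativity of their terms.\<close>
  also have "\<dots> \<le> 6 * (\<Sum>p = 1..m + 1. edge_weight h R p * S p)"
  proof -
    have "(\<Sum>p = 2..<2 + (m - 2). edge_weight h R p * S p) = (\<Sum>p = 2..<2 + (m - 2). 3 * \<kappa> * S p)"
      using w(1) False m by (intro sum.cong) auto
    moreover have "0 \<le> edge_weight h R m * S m" "0 \<le> edge_weight h R (m + 1) * S (m + 1)"
      using w False S by auto
    moreover have "edge_weight h R 1 = 3 * \<kappa>" using w(1)[of 1] False m by auto
    ultimately show ?thesis unfolding sumsplit 
      by (simp add: sum_distrib_left algebra_simps)
  qed
  finally show ?thesis .
qed

section \<open>Toeplitz quadratic forms\<close>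

text \<open>Zero extension turns the truncated Toeplitz matrix into a convolution on the integers,
  so rows near the boundary need no separate treatment.\<close>

definition extension :: "real vec \<Rightarrow> int \<Rightarrow> real" where
  "extension v i = (if 0 \<le> i \<and> i < int (dim_vec v) then v $ nat i else 0)"

lemma finite_support_extension: "finite {i. extension v i \<noteq> 0}"
  by (rule finite_subset[of _ "{0..<int (dim_vec v)}"]) (auto simp: extension_def split: if_splits)

lemma extension_int: "i < dim_vec v \<Longrightarrow> extension v (int i) = v $ i"
  by (simp add: extension_def)

text \<open>Outside the index range \<open>extension v\<close> vanishes, so \<open>g\<close> may
  take any values there.\<close>

lemma sum_mult_vec_eq_Sum_any:
  "(\<Sum>j<dim_vec v. g (int j) * v $ j) = (\<Sum>i. g i * extension v i)"
proof -
  have "(\<Sum>i. g i * extension v i) = (\<Sum>i\<in>int ` {..<dim_vec v}. g i * extension v i)"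
  proof (rule Sum_any.expand_superset)
    show "{i. g i * extension v i \<noteq> 0} \<subseteq> int ` {..<dim_vec v}"
    proof
      fix i assume "i \<in> {i. g i * extension v i \<noteq> 0}"
      then have "i = int (nat i)" "nat i < dim_vec v"
        by (auto simp: extension_def split: if_splits)
      then show "i \<in> int ` {..<dim_vec v}" by blast
    qed
  qed simp
  also have "\<dots> = (\<Sum>j<dim_vec v. g (int j) * extension v (int j))"
    by (subst sum.reindex) auto
  finally show ?thesis by (simp add: extension_int)
qed

lemma scalar_prod_self_eq_lag_product: "v \<bullet> v = lag_product (extension v) 0"
proof -
  have "v \<bullet> v = (\<Sum>j<dim_vec v. extension v (int j) * v $ j)"
    by (simp add: scalar_prod_def extension_int atLeast0LessThan)
  then show ?thesis by (simp add: sum_mult_vec_eq_Sum_any lag_product_def)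
qed

lemma sum_symmetric_interval:
  fixes g :: "int \<Rightarrow> real"
  assumes "\<And>k. g (- k) = g k"
  shows "(\<Sum>k = - int M..int M. g k) = g 0 + 2 * (\<Sum>p = 1..M. g (int p))"
proof (induction M)
  case (Suc M)
  have "{- int (Suc M)..int (Suc M)} = insert (- int (Suc M)) (insert (int (Suc M)) {- int M..int M})"
    by auto
  then show ?case using Suc assms[of "int (Suc M)"] by simp
qed simp

text \<open>Summed along diagonals, the form is a combination of autocorrelations. The condition on
  \<open>a 0\<close> pairs each one with the autocorrelation at lag \<open>0\<close>, and
  \<open>lag_energy_eq\<close> turns the pairs into lag energies.\<close>

lemma toeplitz_quadratic_form:
  fixes a :: "nat \<Rightarrow> real"
  assumes v: "v \<in> carrier_vec N"
    and band: "\<And>p. p > M \<Longrightarrow> a p = 0"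
    and a0: "a 0 = - 2 * (\<Sum>p = 1..M. a p)"
  shows "(mat N N (\<lambda>(i, j). a (nat \<bar>int i - int j\<bar>)) *\<^sub>v v) \<bullet> v =
    - (\<Sum>p = 1..M. a p * lag_energy (extension v) (int p))"
proof -
  let ?f = "extension v" and ?A = "mat N N (\<lambda>(i, j). a (nat \<bar>int i - int j\<bar>))"
  have dim: "dim_vec v = N" using v by simp
  have row: "(?A *\<^sub>v v) $ i = (\<Sum>k = - int M..int M. a (nat \<bar>k\<bar>) * ?f (int i + k))" if "i < N" for i
  proof -
    have "(?A *\<^sub>v v) $ i = (\<Sum>j<N. a (nat \<bar>int i - int j\<bar>) * v $ j)"
      using that dim by (simp add: scalar_prod_def atLeast0LessThan)
    also have "\<dots> = (\<Sum>j. a (nat \<bar>int i - j\<bar>) * ?f j)"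
      using sum_mult_vec_eq_Sum_any[where v = v and g = "\<lambda>j. a (nat \<bar>int i - j\<bar>)"] dim by simp
    \<comment> \<open>The new summation index is the offset from the diagonal.\<close>
    also have "\<dots> = (\<Sum>k. a (nat \<bar>int i - (k + int i)\<bar>) * ?f (k + int i))"
      by (rule Sum_any_shift[symmetric])
    also have "\<dots> = (\<Sum>k. a (nat \<bar>k\<bar>) * ?f (int i + k))"
      by (intro Sum_any.cong) (simp add: add.commute)
    also have "\<dots> = (\<Sum>k = - int M..int M. a (nat \<bar>k\<bar>) * ?f (int i + k))"
    proof (rule Sum_any.expand_superset)
      show "{k. a (nat \<bar>k\<bar>) * ?f (int i + k) \<noteq> 0} \<subseteq> {- int M..int M}"
      proof
        fix k assume "k \<in> {k. a (nat \<bar>k\<bar>) * ?f (int i + k) \<noteq> 0}"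
        then have "\<not> nat \<bar>k\<bar> > M" using band by auto
        then show "k \<in> {- int M..int M}" by auto
      qed
    qed simp
    finally show ?thesis .
  qed
  have "(?A *\<^sub>v v) \<bullet> v = (\<Sum>i<N. (\<Sum>k = - int M..int M. a (nat \<bar>k\<bar>) * ?f (int i + k)) * v $ i)"
    using dim row by (simp only: scalar_prod_def atLeast0LessThan) (auto intro: sum.cong)
  \<comment> \<open>Exchanging the sums makes each diagonal contribute a single
    autocorrelation.\<close>
  also have "\<dots> = (\<Sum>k = - int M..int M. a (nat \<bar>k\<bar>) * (\<Sum>i<N. ?f (int i + k) * v $ i))"
    by (simp add: sum_distrib_right sum_distrib_left mult.assoc) (rule sum.swap)
  also have "\<dots> = (\<Sum>k = - int M..int M. a (nat \<bar>k\<bar>) * lag_product ?f k)"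
    using sum_mult_vec_eq_Sum_any[where v = v and g = "\<lambda>i. ?f (i + k)" for k] dim
    by (simp add: lag_product_def mult.commute)
  also have "\<dots> = a 0 * lag_product ?f 0 + 2 * (\<Sum>p = 1..M. a p * lag_product ?f (int p))"
    by (subst sum_symmetric_interval) (simp_all add: lag_product_minus[OF finite_support_extension])
  also have "\<dots> = - (\<Sum>p = 1..M. a p * lag_energy ?f (int p))"
    unfolding lag_energy_eq[OF finite_support_extension] a0
    by (simp add: sum_distrib_right sum_distrib_left algebra_simps sum_subtractf sum_negf)
  finally show ?thesis .
qed

section \<open>Linear interpolation from the coarse grid\<close>

lemma prolongation_carrier: "prolongation J \<in> carrier_mat (2^J - 1) (2^(J-1) - 1)"
  by (simp add: prolongation_def restriction_def)

text \<open>The factor \<open>2\<close> in the prolongation turns the averaging stencil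
  \<open>1/4, 1/2, 1/4\<close> into the weights \<open>1/2, 1, 1/2\<close> of linear
  interpolation.\<close>

lemma prolongation_vec:
  assumes "w \<in> carrier_vec (2^(J-1) - 1)" "k < 2^J - 1"
  shows "(prolongation J *\<^sub>v w) $ k = (\<Sum>l<dim_vec w.
    (if k = 2 * l \<or> k = 2 * l + 2 then 1 / 2 else if k = 2 * l + 1 then 1 else 0) * w $ l)"
proof -
  have dim: "dim_vec w = 2^(J-1) - 1" using assms(1) by (rule carrier_vecD)
  have "(prolongation J *\<^sub>v w) $ k = (\<Sum>l<dim_vec w. prolongation J $$ (k, l) * w $ l)"
    using assms(2) carrier_matD[OF prolongation_carrier[of J]]
    by (simp add: scalar_prod_def dim atLeast0LessThan)
  also have "\<dots> = (\<Sum>l<dim_vec w.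
      (if k = 2 * l \<or> k = 2 * l + 2 then 1 / 2 else if k = 2 * l + 1 then 1 else 0) * w $ l)"
    using assms(2) by (intro sum.cong) (auto simp: prolongation_def restriction_def dim)
  finally show ?thesis .
qed

text \<open>With indices starting at \<open>0\<close>, the odd fine positions are the coarse grid
  points, and interpolation reproduces the values there.\<close>

lemma prolongation_odd:
  assumes "w \<in> carrier_vec (2^(J-1) - 1)" "2 * i + 1 < 2^J - 1" "i < 2^(J-1) - 1"
  shows "(prolongation J *\<^sub>v w) $ (2 * i + 1) = w $ i"
proof -
  have odd: "(if 2 * i + 1 = 2 * l \<or> 2 * i + 1 = 2 * l + 2 then 1 / 2
      else if 2 * i + 1 = 2 * l + 1 then 1 else 0) = (if l = i then 1 else (0::real))" for l
  proof -
    have "2 * i + 1 \<noteq> 2 * l" "2 * i + 1 \<noteq> 2 * l + 2" by presburger+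
    then show ?thesis by simp
  qed
  show ?thesis
    using assms(3) carrier_vecD[OF assms(1)]
    unfolding prolongation_vec[OF assms(1,2)] odd
    by (simp add: if_distrib[of "\<lambda>x. x * _"] cong: if_cong)
qed

text \<open>Using \<open>extension w\<close> supplies the zero boundary values for the first and the
  last fine position.\<close>

lemma prolongation_even:
  assumes "w \<in> carrier_vec (2^(J-1) - 1)" "2 * i < 2^J - 1"
  shows "(prolongation J *\<^sub>v w) $ (2 * i) = (extension w (int i - 1) + extension w (int i)) / 2"
proof -
  have even: "(if 2 * i = 2 * l \<or> 2 * i = 2 * l + 2 then 1 / 2 else if 2 * i = 2 * l + 1 then 1 else 0)
      = (if l + 1 = i then 1 / 2 else 0) + (if l = i then 1 / 2 else (0::real))" for l
  proof -
    have "2 * i \<noteq> 2 * l + 1" by presburger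
    then show ?thesis by auto
  qed
  have "(\<Sum>l<dim_vec w. (if l = i then 1 / 2 else 0) * w $ l) = extension w (int i) / 2"
    by (simp add: if_distrib[of "\<lambda>x. x * _"] extension_def cong: if_cong)
  moreover have "(\<Sum>l<dim_vec w. (if l + 1 = i then 1 / 2 else 0) * w $ l) = extension w (int i - 1) / 2"
    by (cases i) (simp_all add: if_distrib[of "\<lambda>x. x * _"] extension_def cong: if_cong)
  ultimately show ?thesis
    unfolding prolongation_vec[OF assms] even by (simp add: distrib_right sum.distrib)
qed

text \<open>The coarse values can be read off at the odd positions. This yields invertibility of the
  coarse matrix.\<close>

lemma prolongation_injective:
  assumes "J \<ge> 1" "w \<in> carrier_vec (2^(J-1) - 1)" "prolongation J *\<^sub>v w = 0\<^sub>v (2^J - 1)"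
  shows "w = 0\<^sub>v (2^(J-1) - 1)"
proof (rule eq_vecI)
  fix i assume i: "i < dim_vec (0\<^sub>v (2^(J-1) - 1) :: real vec)"
  have "(2::nat)^J = 2 * 2^(J-1)" using assms(1) by (cases J) auto
  then have k: "2 * i + 1 < 2^J - 1" using i by simp
  show "w $ i = 0\<^sub>v (2^(J-1) - 1) $ i"
    using prolongation_odd[OF assms(2) k] i k by (simp add: assms(3))
qed (use assms in auto)

lemma sum_even_odd: "(\<Sum>k<2 * n. g k) = (\<Sum>j<n. g (2 * j) + g (2 * j + 1))" 
  for g :: "nat \<Rightarrow> 'a::comm_monoid_add"
  by (induction n) (simp_all add: add.assoc)

text \<open>The error vanishes at the coarse points. At an even position it is half the difference
  of the two adjacent increments, so its square is at most half the sum of their squares. Each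
  increment is adjacent to exactly one even position.\<close>

lemma interpolation_error:
  assumes "J \<ge> 1" and v: "v \<in> carrier_vec (2^J - 1)"
  defines "w \<equiv> vec (2^(J-1) - 1) (\<lambda>i. v $ (2 * i + 1))"
  shows "(v - prolongation J *\<^sub>v w) \<bullet> (v - prolongation J *\<^sub>v w) \<le> lag_energy (extension v) 1 / 2"
proof -
  let ?f = "extension v"
  define n where "n = (2::nat)^(J-1)"
  have n: "n \<ge> 1" "(2::nat)^J = 2 * n" using assms(1) by (cases J; auto simp: n_def)+
  have dim: "dim_vec v = 2 * n - 1" using v n by simp
  have w: "w \<in> carrier_vec (2^(J-1) - 1)" by (simp add: w_def)
  have w_dim: "dim_vec w = n - 1" by (simp add: w_def n_def)
  have w_nth: "w $ j = v $ (2 * j + 1)" if "j < n - 1" for j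
    using that by (simp add: w_def n_def)
  have nn: "(2::nat)^J - 1 = 2 * n - 1" "(2::nat)^(J-1) - 1 = n - 1"
    by (simp_all only: n(2) n_def)
  \<comment> \<open>This holds for every integer \<open>j\<close>: off the coarse grid,
    \<open>2 * j + 1\<close> lies off the fine grid too, and both sides are
    \<open>0\<close>.\<close>
  have w_ext: "extension w j = ?f (2 * j + 1)" for j
  proof -
    have "0 \<le> j \<and> j < int (n - 1) \<longleftrightarrow> 0 \<le> 2 * j + 1 \<and> 2 * j + 1 < int (2 * n - 1)"
      using n(1) by presburger
    then show ?thesis
      by (auto simp: extension_def dim w_dim w_nth nat_add_distrib nat_mult_distrib)
  qed
  have P_dim: "dim_row (prolongation J) = 2 * n - 1"
    by (simp only: carrier_matD(1)[OF prolongation_carrier[of J]] n(2))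
  define e where "e = v - prolongation J *\<^sub>v w"
  define d where "d k = (?f (k + 1) - ?f k)^2 / 2" for k
  have e_dim: "dim_vec e = 2 * n - 1"
    by (simp add: e_def P_dim)
  have e_odd: "e $ (2 * j + 1) = 0" if "j < n - 1" for j
  proof -
    have "(prolongation J *\<^sub>v w) $ (2 * j + 1) = w $ j"
      using that prolongation_odd[OF w, of j] unfolding nn by simp
    then show ?thesis using that by (simp add: e_def w_nth dim P_dim)
  qed
  have e_even: "(e $ (2 * j))^2 \<le> d (2 * int j - 1) + d (2 * int j)" if "j < n" for j
  proof -
    have "(prolongation J *\<^sub>v w) $ (2 * j) = (?f (2 * int j - 1) + ?f (2 * int j + 1)) / 2"
      using that prolongation_even[OF w, of j] w_ext[of "int j"] w_ext[of "int j - 1"]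
      unfolding nn by (simp add: algebra_simps)
    moreover have "v $ (2 * j) = ?f (2 * int j)"
      using that dim by (simp add: extension_def nat_mult_distrib)
    ultimately have e: "e $ (2 * j) =
        ((?f (2 * int j) - ?f (2 * int j - 1)) - (?f (2 * int j + 1) - ?f (2 * int j))) / 2"
      using that by (simp add: e_def P_dim field_simps)
    have "((x - y) / 2)^2 \<le> x^2 / 2 + y^2 / 2" for x y :: real
      using zero_le_power2[of "x + y"] by (simp add: power2_eq_square field_simps)
    moreover have "2 * int j - 1 + 1 = 2 * int j" by simp
    ultimately show ?thesis unfolding e d_def by metis
  qed
  have n1: "n = Suc (n - 1)" using n by simp
  have "e \<bullet> e = (\<Sum>k<2 * n - 1. (e $ k)^2)"
    by (simp add: scalar_prod_def e_dim atLeast0LessThan power2_eq_square)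
  \<comment> \<open>The number of positions is odd, so the last even position is split off before
    pairing.\<close>
  also have "\<dots> = (\<Sum>k<2 * (n - 1). (e $ k)^2) + (e $ (2 * (n - 1)))^2"
  proof -
    have "2 * n - 1 = Suc (2 * (n - 1))" using n by simp
    then show ?thesis by simp
  qed
  also have "\<dots> = (\<Sum>j<n. (e $ (2 * j))^2)"
    using e_odd by (subst (2) n1) (simp add: sum_even_odd)
  \<comment> \<open>The increments run from index \<open>- 1\<close> to \<open>2 * n - 2\<close>,
    thus including the steps into and out of the zero extension.\<close>
  also have "\<dots> \<le> (\<Sum>j<n. d (int (2 * j) - 1) + d (int (2 * j + 1) - 1))"
    using e_even by (intro sum_mono) simp
  also have "\<dots> = (\<Sum>k<2 * n. d (int k - 1))"
    by (rule sum_even_odd[symmetric])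
  also have "\<dots> = (\<Sum>k\<in>(\<lambda>k. int k - 1) ` {..<2 * n}. d k)"
    by (subst sum.reindex) (auto simp: inj_on_def)
  also have "\<dots> = Sum_any d"
  proof (rule Sum_any.expand_superset[symmetric])
    show "{k. d k \<noteq> 0} \<subseteq> (\<lambda>k. int k - 1) ` {..<2 * n}"
    proof
      fix k assume "k \<in> {k. d k \<noteq> 0}"
      then have "-1 \<le> k" "k < 2 * int n - 1"
        using dim n(1) by (auto simp: d_def extension_def split: if_splits)
      then show "k \<in> (\<lambda>k. int k - 1) ` {..<2 * n}"
        by (intro image_eqI[of _ _ "nat (k + 1)"]) auto
    qed
  qed simp
  also have "\<dots> = lag_energy ?f 1 / 2"
  proof -
    have "finite {k. (?f (k + 1) - ?f k)\<^sup>2 \<noteq> 0}"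
      using finite_support_comb[OF finite_support_extension, where \<phi> = "\<lambda>x y. (x - y)^2" and k = 1 and l = 0] 
      by simp
    then have "Sum_any (\<lambda>k. (?f (k + 1) - ?f k)\<^sup>2 * (1 / 2)) = lag_energy ?f 1 * (1 / 2)"
      unfolding lag_energy_def by (intro Sum_any_left_distrib[symmetric])
    then show ?thesis by (simp add: d_def[abs_def])
  qed
  finally show ?thesis by (simp add: e_def)
qed

section \<open>Convergence of an abstract two-grid method\<close>

lemma mat_inv_eq:
  assumes A: "A \<in> carrier_mat n n" and B: "B \<in> carrier_mat n n"
    and inv: "A * B = 1\<^sub>m n" "B * A = 1\<^sub>m n"
  shows "mat_inv A = B"
proof (cases "mat_inverse A")
  case None
  \<comment> \<open>A two-sided inverse makes \<open>A\<close> a unit, so \<open>mat_inverse\<close>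
    cannot return \<open>None\<close>.\<close>
  have "A \<in> Units (ring_mat TYPE(real) n ())"
    using A B inv by (auto simp: Units_def ring_mat_def)
  with mat_inverse(1)[OF A None, of "()"] show ?thesis by blast
next
  case (Some C)
  note C = mat_inverse(2)[OF A Some]
  then have "C = C * (A * B)" using inv(1) right_mult_one_mat[of C n n] by metis
  also have "\<dots> = (C * A) * B" using A B C by (intro assoc_mult_mat[symmetric]) auto
  finally show ?thesis using B C Some by (simp add: mat_inv_def)
qed

text \<open>A trivial kernel means a non-zero determinant. For the coarse matrix the kernel is
  controlled through the energy.\<close>

lemma mat_inv_right:
  assumes A: "A \<in> carrier_mat n n"
    and ker: "\<And>v. v \<in> carrier_vec n \<Longrightarrow> A *\<^sub>v v = 0\<^sub>v n \<Longrightarrow> v = 0\<^sub>v n"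
  shows "mat_inv A \<in> carrier_mat n n" "A * mat_inv A = 1\<^sub>m n"
proof -
  have "det A \<noteq> 0" using det_0_iff_vec_prod_zero_field[OF A] ker by blast
  then have "A \<in> Units (ring_mat TYPE(real) n ())" by (rule det_non_zero_imp_unit[OF A])
  then obtain B where "mat_inverse A = Some B"
    using mat_inverse(1)[OF A, of "()"] by (cases "mat_inverse A") auto
  with mat_inverse(2)[OF A this]
  show "mat_inv A \<in> carrier_mat n n" "A * mat_inv A = 1\<^sub>m n" by (auto simp: mat_inv_def)
qed

lemma smult_mat_mult_vec:
  fixes c :: "'a::comm_ring"
  assumes "A \<in> carrier_mat nr nc" "v \<in> carrier_vec nc"
  shows "(c \<cdot>\<^sub>m A) *\<^sub>v v = c \<cdot>\<^sub>v (A *\<^sub>v v)"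
  using assms by (intro eq_vecI) auto

lemma scalar_prod_self_nonneg: "0 \<le> v \<bullet> v" for v :: "real vec"
  by (simp add: scalar_prod_def sum_nonneg)

text \<open>Expand the squared length of \<open>t g - e\<close> and divide by \<open>2 * t\<close>.
  The parameter is later tuned so that the second term can be absorbed.\<close>

lemma young_scalar_prod:
  fixes g e :: "real vec"
  assumes "g \<in> carrier_vec n" "e \<in> carrier_vec n" "t > 0"
  shows "g \<bullet> e \<le> t / 2 * (g \<bullet> g) + (e \<bullet> e) / (2 * t)"
proof -
  have "0 \<le> (t \<cdot>\<^sub>v g - e) \<bullet> (t \<cdot>\<^sub>v g - e)" by (rule scalar_prod_self_nonneg)
  also have "\<dots> = t^2 * (g \<bullet> g) - 2 * t * (g \<bullet> e) + e \<bullet> e"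
    using assms comm_scalar_prod[of g n e]
    by (simp add: minus_scalar_prod_distrib[of _ n] scalar_prod_minus_distrib[of _ n] 
        power2_eq_square algebra_simps)
  finally show ?thesis using assms(3) by (simp add: power2_eq_square field_simps)
qed

section \<open>The energy form of a symmetric matrix\<close>

context
  fixes A :: "real mat" and N :: nat
  assumes A: "A \<in> carrier_mat N N" and sym: "transpose_mat A = A"
begin

lemma form_symmetric:
  assumes "u \<in> carrier_vec N" "w \<in> carrier_vec N"
  shows "(A *\<^sub>v u) \<bullet> w = (A *\<^sub>v w) \<bullet> u"
  using transpose_vec_mult_scalar[OF A assms(2,1)] sym A assms
  by (simp add: comm_scalar_prod[of u N])

lemma form_diff:
  assumes "u \<in> carrier_vec N" "w \<in> carrier_vec N"
  shows "(A *\<^sub>v (u - w)) \<bullet> (u - w) = (A *\<^sub>v u) \<bullet> u - 2 * ((A *\<^sub>v u) \<bullet> w) + (A *\<^sub>v w) \<bullet> w"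
proof -
  have "A *\<^sub>v u \<in> carrier_vec N" "A *\<^sub>v w \<in> carrier_vec N" using A assms by auto
  then show ?thesis
    using A assms form_symmetric[OF assms]
    by (simp add: mult_minus_distrib_mat_vec[of A N N] minus_scalar_prod_distrib[of _ N] 
        scalar_prod_minus_distrib[of _ N])
qed

text \<open>\<open>g\<close> is the gradient of half the energy. The linear term gains
  \<open>2 * c * (g \<bullet> g)\<close>, and the bound \<open>L\<close> limits the loss in the
  quadratic term.\<close>

lemma form_gradient_step:
  assumes u: "u \<in> carrier_vec N" and max: "\<And>v. v \<in> carrier_vec N \<Longrightarrow> (A *\<^sub>v v) \<bullet> v \<le> L * (v \<bullet> v)"
  defines "g \<equiv> A *\<^sub>v u"
  shows "(A *\<^sub>v (u - c \<cdot>\<^sub>v g)) \<bullet> (u - c \<cdot>\<^sub>v g) \<le> (A *\<^sub>v u) \<bullet> u - (2 * c - L * c^2) * (g \<bullet> g)"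
proof -
  have g: "g \<in> carrier_vec N" using A u by (simp add: g_def)
  then have Ag: "A *\<^sub>v g \<in> carrier_vec N" using A by simp
  have cg: "c \<cdot>\<^sub>v g \<in> carrier_vec N" using g by simp
  have "(A *\<^sub>v (u - c \<cdot>\<^sub>v g)) \<bullet> (u - c \<cdot>\<^sub>v g) = (A *\<^sub>v u) \<bullet> u - 2 * c * (g \<bullet> g) + c^2 * ((A *\<^sub>v g) \<bullet> g)"
    unfolding form_diff[OF u cg] mult_mat_vec[OF A g]
    using g Ag by (simp add: power2_eq_square flip: g_def)
  also have "\<dots> \<le> (A *\<^sub>v u) \<bullet> u - 2 * c * (g \<bullet> g) + c^2 * (L * (g \<bullet> g))"
    by (intro add_left_mono mult_left_mono max g) simp
  finally show ?thesis by (simp add: algebra_simps)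
qed

end

section \<open>Damped Jacobi smoothing and coarse-grid correction\<close>

lemma mat_inv_diag_part_const:
  assumes "A \<in> carrier_mat N N" "\<And>i. i < N \<Longrightarrow> A $$ (i, i) = d" "d \<noteq> 0"
  shows "mat_inv (diag_part A) = (1 / d) \<cdot>\<^sub>m 1\<^sub>m N"
proof (rule mat_inv_eq)
  have eq: "diag_part A = d \<cdot>\<^sub>m 1\<^sub>m N"
    using assms by (intro eq_matI) (auto simp: diag_part_def mat_diag_def)
  show "diag_part A \<in> carrier_mat N N" by (simp add: eq)
  show "diag_part A * ((1 / d) \<cdot>\<^sub>m 1\<^sub>m N) = 1\<^sub>m N" "(1 / d) \<cdot>\<^sub>m 1\<^sub>m N * diag_part A = 1\<^sub>m N"
    using assms(3) unfolding eq by (intro eq_matI; simp)+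
qed simp

text \<open>For a constant diagonal \<open>d\<close>, damped Jacobi is a gradient step of length
  \<open>\<omega> / d\<close>.\<close>

lemma damped_jacobi_vec:
  assumes A: "A \<in> carrier_mat N N" and d: "\<And>i. i < N \<Longrightarrow> A $$ (i, i) = d" "d \<noteq> 0"
    and v: "v \<in> carrier_vec N"
  shows "damped_jacobi \<omega> A *\<^sub>v v = v - (\<omega> / d) \<cdot>\<^sub>v (A *\<^sub>v v)"
proof -
  have "damped_jacobi \<omega> A = 1\<^sub>m N - (\<omega> / d) \<cdot>\<^sub>m A"
    using A mat_inv_diag_part_const[of A N d] d by (intro eq_matI) (auto simp: damped_jacobi_def)
  then show ?thesis
    using A v by (simp add: minus_mult_distrib_mat_vec[of _ N N] smult_mat_mult_vec[of _ N N])
qed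

text \<open>The prolongation is twice the adjoint of the restriction, so a vanishing restricted
  residual means energy orthogonality to all prolonged vectors. Definiteness and injectivity of the
  prolongation make the coarse matrix invertible.\<close>

lemma coarse_correction_galerkin:
  assumes J: "J \<ge> 1" and A: "A \<in> carrier_mat (2^J - 1) (2^J - 1)"
    and pos: "\<And>v. v \<in> carrier_vec (2^J - 1) \<Longrightarrow> v \<noteq> 0\<^sub>v (2^J - 1) \<Longrightarrow> 0 < (A *\<^sub>v v) \<bullet> v"
    and v: "v \<in> carrier_vec (2^J - 1)"
  obtains z where "z \<in> carrier_vec (2^(J-1) - 1)"
    "coarse_correction J A *\<^sub>v v = v - prolongation J *\<^sub>v z"
    "\<And>w. w \<in> carrier_vec (2^(J-1) - 1) \<Longrightarrow>
      (A *\<^sub>v (coarse_correction J A *\<^sub>v v)) \<bullet> (prolongation J *\<^sub>v w) = 0"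
proof -
  define N n where "N = (2::nat)^J - 1" and "n = (2::nat)^(J-1) - 1"
  let ?P = "prolongation J" and ?R = "restriction J" and ?C = "coarse_mat J A"
  note [simp] = A[folded N_def]
  have P [simp]: "?P \<in> carrier_mat N n" and R [simp]: "?R \<in> carrier_mat n N"
    using prolongation_carrier by (auto simp: restriction_def N_def n_def)
  have C [simp]: "?C \<in> carrier_mat n n" 
    unfolding coarse_mat_def by (intro mult_carrier_mat[of _ n N]) auto
  have adj: "y \<bullet> (?P *\<^sub>v w) = 2 * ((?R *\<^sub>v y) \<bullet> w)"
    if [simp]: "y \<in> carrier_vec N" "w \<in> carrier_vec n" for y w
  proof -
    have "?P *\<^sub>v w = 2 \<cdot>\<^sub>v (transpose_mat ?R *\<^sub>v w)"
      unfolding prolongation_def by (rule smult_mat_mult_vec[of _ N n]) auto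
    moreover have "transpose_mat ?R *\<^sub>v w \<in> carrier_vec N"
      by (rule mult_mat_vec_carrier[of _ N n]) auto
    ultimately show ?thesis
      using transpose_vec_mult_scalar[OF R that]
      by (simp add: comm_scalar_prod[of y N] comm_scalar_prod[of w n] mult_mat_vec_carrier[OF R])
  qed
  have C_vec: "?C *\<^sub>v w = ?R *\<^sub>v (A *\<^sub>v (?P *\<^sub>v w))" if [simp]: "w \<in> carrier_vec n" for w
  proof -
    have "?C *\<^sub>v w = (?R * A) *\<^sub>v (?P *\<^sub>v w)"
      unfolding coarse_mat_def by (rule assoc_mult_mat_vec[OF mult_carrier_mat[OF R] P]) auto
    also have "\<dots> = ?R *\<^sub>v (A *\<^sub>v (?P *\<^sub>v w))"
      by (rule assoc_mult_mat_vec[OF R]) (auto intro: mult_mat_vec_carrier[OF P])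
    finally show ?thesis .
  qed
  have ker: "w = 0\<^sub>v n" if w [simp]: "w \<in> carrier_vec n" and Cw: "?C *\<^sub>v w = 0\<^sub>v n" for w
  proof (rule ccontr)
    assume "w \<noteq> 0\<^sub>v n"
    then have "?P *\<^sub>v w \<noteq> 0\<^sub>v N"
      using prolongation_injective[OF J, folded N_def n_def, OF w] by blast
    moreover have Pw: "?P *\<^sub>v w \<in> carrier_vec N" by (rule mult_mat_vec_carrier[OF P w])
    ultimately have "0 < (A *\<^sub>v (?P *\<^sub>v w)) \<bullet> (?P *\<^sub>v w)"
      using pos by (simp add: N_def)
    also have "\<dots> = 2 * ((?C *\<^sub>v w) \<bullet> w)"
      unfolding C_vec[OF w] by (rule adj[OF mult_mat_vec_carrier[OF A[folded N_def] Pw] w])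
    finally show False by (simp add: Cw)
  qed
  have Ci [simp]: "mat_inv ?C \<in> carrier_mat n n" "?C * mat_inv ?C = 1\<^sub>m n"
    by (rule mat_inv_right[OF C ker]; assumption)+
  have v' [simp]: "v \<in> carrier_vec N" using v by (simp add: N_def)
  define y where "y = ?R *\<^sub>v (A *\<^sub>v v)"
  define z where "z = mat_inv ?C *\<^sub>v y"
  have Av [simp]: "A *\<^sub>v v \<in> carrier_vec N" by (rule mult_mat_vec_carrier[of _ N N]) auto
  have y [simp]: "y \<in> carrier_vec n" unfolding y_def by (rule mult_mat_vec_carrier[OF R]) simp
  have z [simp]: "z \<in> carrier_vec n" unfolding z_def by (rule mult_mat_vec_carrier[of _ n n]) auto
  have Pz [simp]: "?P *\<^sub>v z \<in> carrier_vec N" by (rule mult_mat_vec_carrier[OF P z])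
  have PC [simp]: "?P * mat_inv ?C \<in> carrier_mat N n" by (rule mult_carrier_mat[OF P]) simp
  have PCR [simp]: "?P * mat_inv ?C * ?R \<in> carrier_mat N N" by (rule mult_carrier_mat[OF PC]) simp
  have "(?P * mat_inv ?C * ?R * A) *\<^sub>v v = (?P * mat_inv ?C * ?R) *\<^sub>v (A *\<^sub>v v)"
    by (rule assoc_mult_mat_vec[OF PCR A[folded N_def] v'])
  also have "\<dots> = (?P * mat_inv ?C) *\<^sub>v y"
    unfolding y_def by (rule assoc_mult_mat_vec[OF PC R]) simp
  also have "\<dots> = ?P *\<^sub>v z"
    unfolding z_def by (rule assoc_mult_mat_vec[OF P Ci(1)]) auto
  finally have T: "coarse_correction J A *\<^sub>v v = v - ?P *\<^sub>v z"
    unfolding coarse_correction_def N_def[symmetric]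
    by (subst minus_mult_distrib_mat_vec[OF one_carrier_mat mult_carrier_mat[OF PCR A[folded N_def]] v'])
      simp
  \<comment> \<open>\<open>z\<close> solves the coarse equation whose right-hand side is the
    restricted residual \<open>y\<close>.\<close>
  have RAPz: "?R *\<^sub>v (A *\<^sub>v (?P *\<^sub>v z)) = y"
  proof -
    have "?R *\<^sub>v (A *\<^sub>v (?P *\<^sub>v z)) = ?C *\<^sub>v z" by (simp add: C_vec)
    also have "\<dots> = (?C * mat_inv ?C) *\<^sub>v y"
      unfolding z_def by (rule assoc_mult_mat_vec[OF C Ci(1), symmetric]) simp
    finally show ?thesis by simp
  qed
  have APz [simp]: "A *\<^sub>v (?P *\<^sub>v z) \<in> carrier_vec N" by (rule mult_mat_vec_carrier[of _ N N]) auto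
  have "(A *\<^sub>v (coarse_correction J A *\<^sub>v v)) \<bullet> (?P *\<^sub>v w) = 0" if "w \<in> carrier_vec n" for w
  proof -
    have "A *\<^sub>v (coarse_correction J A *\<^sub>v v) = A *\<^sub>v v - A *\<^sub>v (?P *\<^sub>v z)"
      unfolding T by (rule mult_minus_distrib_mat_vec[of _ N N]) auto
    then have "(A *\<^sub>v (coarse_correction J A *\<^sub>v v)) \<bullet> (?P *\<^sub>v w) 
        = 2 * ((?R *\<^sub>v (A *\<^sub>v v - A *\<^sub>v (?P *\<^sub>v z))) \<bullet> w)"
      by (simp add: adj[OF _ that])
    also have "?R *\<^sub>v (A *\<^sub>v v - A *\<^sub>v (?P *\<^sub>v z)) = y - y"
      by (simp add: mult_minus_distrib_mat_vec[OF R] RAPz flip: y_def)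
    finally show ?thesis using that y by simp
  qed
  then show ?thesis using that z T by (simp add: n_def)
qed

text \<open>After the correction, orthogonality equates the energy of \<open>u\<close> with the
  product of \<open>A u\<close> and any interpolation error of \<open>u\<close>. Approximation then
  bounds this energy by \<open>\<alpha> / d\<close> times the squared length of \<open>A u\<close>,
  so smoothing removes at least the fraction \<open>\<eta> / \<alpha>\<close> of it.\<close>

lemma two_grid_convergence:
  assumes J: "J \<ge> 1" and A: "A \<in> carrier_mat (2^J - 1) (2^J - 1)" and sym: "transpose_mat A = A"
    and pos: "\<And>v. v \<in> carrier_vec (2^J - 1) \<Longrightarrow> v \<noteq> 0\<^sub>v (2^J - 1) \<Longrightarrow> 0 < (A *\<^sub>v v) \<bullet> v"
    and v: "v \<in> carrier_vec (2^J - 1)" and "d > 0" "\<alpha> > 0" "\<eta> \<ge> 0"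
    and approx: "\<And>v. v \<in> carrier_vec (2^J - 1) \<Longrightarrow> \<exists>w \<in> carrier_vec (2^(J-1) - 1).
      d * ((v - prolongation J *\<^sub>v w) \<bullet> (v - prolongation J *\<^sub>v w)) \<le> \<alpha> * ((A *\<^sub>v v) \<bullet> v)"
    and K: "K \<in> carrier_mat (2^J - 1) (2^J - 1)"
    and smooth: "\<And>v. v \<in> carrier_vec (2^J - 1) \<Longrightarrow>
      (A *\<^sub>v (K *\<^sub>v v)) \<bullet> (K *\<^sub>v v) \<le> (A *\<^sub>v v) \<bullet> v - \<eta> * (((A *\<^sub>v v) \<bullet> (A *\<^sub>v v)) / d)"
    and \<eta>: "\<eta> \<le> \<alpha>"
  shows "(A *\<^sub>v ((K * coarse_correction J A) *\<^sub>v v)) \<bullet> ((K * coarse_correction J A) *\<^sub>v v)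
    \<le> (1 - \<eta> / \<alpha>) * ((A *\<^sub>v v) \<bullet> v)"
proof -
  define N where "N = (2::nat)^J - 1"
  let ?P = "prolongation J" and ?T = "coarse_correction J A"
  note A = A[folded N_def] and v = v[folded N_def] and pos = pos[folded N_def]
    and approx = approx[folded N_def] and smooth = smooth[folded N_def] and K = K[folded N_def]
  obtain z where z: "z \<in> carrier_vec (2^(J-1) - 1)" and T: "?T *\<^sub>v v = v - ?P *\<^sub>v z"
    and orth: "\<And>w. w \<in> carrier_vec (2^(J-1) - 1) \<Longrightarrow> (A *\<^sub>v (?T *\<^sub>v v)) \<bullet> (?P *\<^sub>v w) = 0"
    using coarse_correction_galerkin[OF J A[unfolded N_def] pos[unfolded N_def] v[unfolded N_def]]
    by blast
  define u where "u = ?T *\<^sub>v v"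
  define g where "g = A *\<^sub>v u"
  have Pcar: "?P *\<^sub>v w \<in> carrier_vec N" if "w \<in> carrier_vec (2^(J-1) - 1)" for w
    unfolding N_def by (rule mult_mat_vec_carrier[OF prolongation_carrier that])
  have u: "u \<in> carrier_vec N" unfolding u_def T by (intro minus_carrier_vec v Pcar z)
  have g: "g \<in> carrier_vec N" using A u by (simp add: g_def)
  have nonneg: "0 \<le> (A *\<^sub>v x) \<bullet> x" if "x \<in> carrier_vec N" for x
    using pos[OF that] that A by (cases "x = 0\<^sub>v N") auto
  have "(A *\<^sub>v u) \<bullet> u = (A *\<^sub>v v) \<bullet> v - 2 * ((A *\<^sub>v v) \<bullet> (?P *\<^sub>v z)) + (A *\<^sub>v (?P *\<^sub>v z)) \<bullet> (?P *\<^sub>v z)"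
    unfolding u_def T by (rule form_diff[OF A sym v Pcar[OF z]])
  moreover have "(A *\<^sub>v v) \<bullet> (?P *\<^sub>v z) = (A *\<^sub>v (?P *\<^sub>v z)) \<bullet> (?P *\<^sub>v z)"
  proof -
    have "A *\<^sub>v (?T *\<^sub>v v) = A *\<^sub>v v - A *\<^sub>v (?P *\<^sub>v z)"
      unfolding T by (rule mult_minus_distrib_mat_vec[OF A v Pcar[OF z]])
    then show ?thesis
      using orth[OF z] Pcar[OF z] A v by (simp add: minus_scalar_prod_distrib[of _ N])
  qed
  \<comment> \<open>Pythagoras in the energy: the correction is an orthogonal projection and cannot
    increase it.\<close>
  ultimately have T_le: "(A *\<^sub>v u) \<bullet> u \<le> (A *\<^sub>v v) \<bullet> v"
    using nonneg[OF Pcar[OF z]] by simp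
  obtain w where w: "w \<in> carrier_vec (2^(J-1) - 1)"
    and e: "d * ((u - ?P *\<^sub>v w) \<bullet> (u - ?P *\<^sub>v w)) \<le> \<alpha> * ((A *\<^sub>v u) \<bullet> u)"
    using approx[OF u] by blast
  define e where "e = u - ?P *\<^sub>v w"
  have ecar: "e \<in> carrier_vec N" unfolding e_def by (intro minus_carrier_vec u Pcar w)
  have "(A *\<^sub>v u) \<bullet> u = g \<bullet> e"
    using orth[OF w] g u Pcar[OF w]
    by (simp add: e_def scalar_prod_minus_distrib[of _ N] flip: u_def g_def)
  \<comment> \<open>The parameter \<open>\<alpha> / d\<close> makes the error term at most half the
    energy, which is absorbed on the left.\<close>
  also have "\<dots> \<le> (\<alpha> / d) / 2 * (g \<bullet> g) + (e \<bullet> e) / (2 * (\<alpha> / d))"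
    using assms by (intro young_scalar_prod[OF g ecar]) simp
  also have "(e \<bullet> e) / (2 * (\<alpha> / d)) \<le> ((A *\<^sub>v u) \<bullet> u) / 2"
    using e \<open>d > 0\<close> \<open>\<alpha> > 0\<close> unfolding e_def[symmetric] by (simp add: field_simps)
  finally have "(A *\<^sub>v u) \<bullet> u \<le> \<alpha> * ((g \<bullet> g) / d)" by simp
  then have "\<eta> * ((A *\<^sub>v u) \<bullet> u) / \<alpha> \<le> \<eta> * ((g \<bullet> g) / d)"
    using \<open>\<eta> \<ge> 0\<close> \<open>\<alpha> > 0\<close> mult_left_mono[of "(A *\<^sub>v u) \<bullet> u" "\<alpha> * ((g \<bullet> g) / d)" \<eta>]
    by (simp add: divide_le_eq mult_ac)
  then have "(A *\<^sub>v (K *\<^sub>v u)) \<bullet> (K *\<^sub>v u) \<le> (1 - \<eta> / \<alpha>) * ((A *\<^sub>v u) \<bullet> u)"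
    using smooth[OF u] by (simp add: g_def algebra_simps)
  \<comment> \<open>Here \<open>\<eta> \<le> \<alpha>\<close> keeps the factor non-negative.\<close>
  also have "\<dots> \<le> (1 - \<eta> / \<alpha>) * ((A *\<^sub>v v) \<bullet> v)"
    using T_le \<eta> \<open>\<alpha> > 0\<close> by (intro mult_left_mono) auto
  moreover have "(K * ?T) *\<^sub>v v = K *\<^sub>v u"
  proof -
    have "dim_row ?T = N" "dim_col ?T = N"
      using A prolongation_carrier[of J] by (auto simp: coarse_correction_def N_def)
    then show ?thesis unfolding u_def by (intro assoc_mult_mat_vec[OF K _ v]) auto
  qed
  ultimately show ?thesis by simp
qed

section \<open>The nonlocal stiffness matrix\<close>

text \<open>Both defining cases of the diagonal take this form: for \<open>R \<le> 1\<close> the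
  only non-zero weight is \<open>1 / h^2\<close>, at lag \<open>1\<close>.\<close>

lemma toeplitz_coeff_0:
  assumes "h > 0" "R > 0"
  shows "toeplitz_coeff h R 0 = 2 * (\<Sum>p = 1..nat \<lfloor>R\<rfloor> + 1. edge_weight h R p)"
proof (cases "R \<le> 1")
  case True
  have "edge_weight h R p = 0" if "p > 1" for p
    using True that by (simp add: edge_weight_def toeplitz_offdiag_def)
  then have "(\<Sum>p = 1..nat \<lfloor>R\<rfloor> + 1. edge_weight h R p) = (\<Sum>p = 1..1. edge_weight h R p)"
    by (intro sum.mono_neutral_right) auto
  then show ?thesis using True by (simp add: toeplitz_coeff_def edge_weight_def toeplitz_offdiag_def)
next
  case False
  then show ?thesis by (simp add: toeplitz_coeff_def edge_weight_def sum_negf)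
qed

lemma toeplitz_coeff_pos: "p \<ge> 1 \<Longrightarrow> toeplitz_coeff h R p = - edge_weight h R p"
  by (simp add: toeplitz_coeff_def edge_weight_def)

lemma toeplitz_coeff_beyond_band: "p > nat \<lfloor>R\<rfloor> + 1 \<Longrightarrow> toeplitz_coeff h R p = 0"
  by (simp add: toeplitz_coeff_def toeplitz_offdiag_def Let_def)

lemma toeplitz_coeff_0_pos:
  assumes "h > 0" "R > 0"
  shows "0 < toeplitz_coeff h R 0"
proof -
  have "0 < (\<Sum>p = 1..nat \<lfloor>R\<rfloor> + 1. edge_weight h R p)"
    using edge_weight_1_pos[OF assms] edge_weight_nonneg[OF assms]
    by (intro sum_pos2[of _ 1]) auto
  then show ?thesis using toeplitz_coeff_0[OF assms] by simp
qed

text \<open>Zero energy would make the extension constant, and it vanishes at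
  \<open>- 1\<close>.\<close>

lemma lag_energy_1_pos:
  assumes "v \<noteq> 0\<^sub>v (dim_vec v)"
  shows "0 < lag_energy (extension v) 1"
proof (rule ccontr)
  let ?f = "extension v"
  let ?F = "{i. (?f (i + 1) - ?f i)\<^sup>2 \<noteq> 0}"
  assume "\<not> 0 < lag_energy ?f 1"
  then have "sum (\<lambda>i. (?f (i + 1) - ?f i)\<^sup>2) ?F = 0"
    using lag_energy_nonneg[OF finite_support_extension, of v 1]
    by (simp add: lag_energy_def Sum_any.expand_set)
  moreover have "finite ?F"
    using finite_support_comb[OF finite_support_extension,
        where \<phi> = "\<lambda>x y. (x - y)^2" and k = 1 and l = 0] by simp
  ultimately have "\<forall>i\<in>?F. (?f (i + 1) - ?f i)\<^sup>2 = 0"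
    by (subst (asm) sum_nonneg_eq_0_iff) auto
  then have step: "?f (i + 1) = ?f i" for i by auto
  have "?f (int k) = 0" for k
  proof (induction k)
    case 0
    then show ?case using step[of "- 1"] by (simp add: extension_def)
  next
    case (Suc k)
    then show ?case using step[of "int k"] by (simp add: add.commute)
  qed
  then have "v = 0\<^sub>v (dim_vec v)" by (intro eq_vecI) (auto simp: extension_int[of _ v, symmetric])
  with assms show False by simp
qed

context
  fixes h R :: real and N :: nat and A :: "real mat"
  assumes h: "h > 0" and R: "R > 0"
    and A_eq: "A = mat N N (\<lambda>(i, j). toeplitz_coeff h R (nat \<bar>int i - int j\<bar>))"
begin

lemma stiffness_form:
  assumes v: "v \<in> carrier_vec N"
  shows "(A *\<^sub>v v) \<bullet> v =
    (\<Sum>p = 1..nat \<lfloor>R\<rfloor> + 1. edge_weight h R p * lag_energy (extension v) (int p))"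
proof -
  have "(A *\<^sub>v v) \<bullet> v =
      - (\<Sum>p = 1..nat \<lfloor>R\<rfloor> + 1. toeplitz_coeff h R p * lag_energy (extension v) (int p))"
    unfolding A_eq
  proof (rule toeplitz_quadratic_form[OF v])
    have "(\<Sum>p = 1..nat \<lfloor>R\<rfloor> + 1. toeplitz_coeff h R p) = (\<Sum>p = 1..nat \<lfloor>R\<rfloor> + 1. - edge_weight h R p)"
      by (intro sum.cong) (auto simp: toeplitz_coeff_pos)
    then show "toeplitz_coeff h R 0 = - 2 * (\<Sum>p = 1..nat \<lfloor>R\<rfloor> + 1. toeplitz_coeff h R p)"
      by (simp only: toeplitz_coeff_0[OF h R] sum_negf)
  qed (rule toeplitz_coeff_beyond_band)
  also have "\<dots> = (\<Sum>p = 1..nat \<lfloor>R\<rfloor> + 1. edge_weight h R p * lag_energy (extension v) (int p))"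
    unfolding sum_negf[symmetric] by (intro sum.cong) (auto simp: toeplitz_coeff_pos)
  finally show ?thesis .
qed

lemma stiffness_pos:
  assumes v: "v \<in> carrier_vec N" "v \<noteq> 0\<^sub>v N"
  shows "0 < (A *\<^sub>v v) \<bullet> v"
  unfolding stiffness_form[OF v(1)]
proof (intro sum_pos2[of _ 1])
  show "0 < edge_weight h R 1 * lag_energy (extension v) (int 1)"
    using edge_weight_1_pos[OF h R] lag_energy_1_pos[of v] v by auto
qed (auto intro!: mult_nonneg_nonneg edge_weight_nonneg h R lag_energy_nonneg finite_support_extension)

text \<open>Each lag energy is at most \<open>4 * (v \<bullet> v)\<close>, and the weights add up to
  half the diagonal entry.\<close>

lemma stiffness_le:
  assumes v: "v \<in> carrier_vec N"
  shows "(A *\<^sub>v v) \<bullet> v \<le> 2 * toeplitz_coeff h R 0 * (v \<bullet> v)"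
proof -
  have "(A *\<^sub>v v) \<bullet> v \<le> (\<Sum>p = 1..nat \<lfloor>R\<rfloor> + 1. edge_weight h R p * (4 * (v \<bullet> v)))"
    unfolding stiffness_form[OF v] scalar_prod_self_eq_lag_product
    by (intro sum_mono mult_left_mono lag_energy_le finite_support_extension edge_weight_nonneg h R) auto
  also have "\<dots> = (\<Sum>p = 1..nat \<lfloor>R\<rfloor> + 1. edge_weight h R p) * (4 * (v \<bullet> v))"
    by (rule sum_distrib_right[symmetric])
  also have "\<dots> = toeplitz_coeff h R 0 / 2 * (4 * (v \<bullet> v))"
    unfolding toeplitz_coeff_0[OF h R] by linarith
  finally show ?thesis by (simp add: mult_ac)
qed

text \<open>The left-hand side is the total weight times the energy at lag \<open>1\<close>, so
  \<open>edge_weight_comparison\<close> applies to the lag energies.\<close>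

lemma stiffness_ge_lag_energy:
  assumes v: "v \<in> carrier_vec N"
  shows "toeplitz_coeff h R 0 * (lag_energy (extension v) 1 / 2) \<le> 6 * ((A *\<^sub>v v) \<bullet> v)"
proof -
  have "lag_energy (extension v) (int 1)
      \<le> 2 * lag_energy (extension v) (int p) + 2 * lag_energy (extension v) (int (p + 1))" for p
    using lag_energy_1_le[OF finite_support_extension, of v "int p"] by (simp add: add.commute)
  then have "(\<Sum>p = 1..nat \<lfloor>R\<rfloor> + 1. edge_weight h R p) * lag_energy (extension v) (int 1)
      \<le> 6 * (\<Sum>p = 1..nat \<lfloor>R\<rfloor> + 1. edge_weight h R p * lag_energy (extension v) (int p))"
    by (intro edge_weight_comparison[OF h R] lag_energy_nonneg finite_support_extension)
  moreover have "2 * x * (y / 2) = x * y" for x y :: real by simp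
  ultimately show ?thesis
    unfolding stiffness_form[OF v] toeplitz_coeff_0[OF h R] by (simp only: of_nat_1)
qed

lemma stiffness_approximation:
  assumes "N = 2^J - 1" "J \<ge> 1" "v \<in> carrier_vec N"
  shows "\<exists>w \<in> carrier_vec (2^(J-1) - 1). toeplitz_coeff h R 0 *
    ((v - prolongation J *\<^sub>v w) \<bullet> (v - prolongation J *\<^sub>v w)) \<le> 6 * ((A *\<^sub>v v) \<bullet> v)"
proof
  let ?w = "vec (2^(J-1) - 1) (\<lambda>i. v $ (2 * i + 1))"
  show "?w \<in> carrier_vec (2^(J-1) - 1)" by simp
  have "toeplitz_coeff h R 0 * ((v - prolongation J *\<^sub>v ?w) \<bullet> (v - prolongation J *\<^sub>v ?w))
      \<le> toeplitz_coeff h R 0 * (lag_energy (extension v) 1 / 2)"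
    using toeplitz_coeff_0_pos[OF h R] interpolation_error[of J v] assms by (intro mult_left_mono) auto
  also have "\<dots> \<le> 6 * ((A *\<^sub>v v) \<bullet> v)"
    using assms(3) by (rule stiffness_ge_lag_energy)
  finally show "toeplitz_coeff h R 0 *
    ((v - prolongation J *\<^sub>v ?w) \<bullet> (v - prolongation J *\<^sub>v ?w)) \<le> 6 * ((A *\<^sub>v v) \<bullet> v)" .
qed

end

section \<open>From energy bounds to the operator norm, and the convergence theorem\<close>

lemma opnorm_le:
  assumes N: "dim_row M = N" "N > 0" and q: "0 \<le> q"
    and pos: "\<And>v. v \<in> carrier_vec N \<Longrightarrow> v \<noteq> 0\<^sub>v N \<Longrightarrow> 0 < (M *\<^sub>v v) \<bullet> v"
    and le: "\<And>v. v \<in> carrier_vec N \<Longrightarrow> (M *\<^sub>v (B *\<^sub>v v)) \<bullet> (B *\<^sub>v v) \<le> q * ((M *\<^sub>v v) \<bullet> v)"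
  shows "opnorm M B \<le> sqrt q"
  unfolding opnorm_def N(1)
proof (rule cSUP_least)
  \<comment> \<open>A unit vector shows that the supremum ranges over a non-empty set.\<close>
  have "unit_vec N 0 $ 0 \<noteq> (0\<^sub>v N $ 0 :: real)" using N(2) by simp
  then have "unit_vec N 0 \<noteq> (0\<^sub>v N :: real vec)" by metis
  then show "carrier_vec N - {0\<^sub>v N :: real vec} \<noteq> {}" using unit_vec_carrier by blast
  fix v :: "real vec" assume "v \<in> carrier_vec N - {0\<^sub>v N}"
  then have v: "v \<in> carrier_vec N" "0 < (M *\<^sub>v v) \<bullet> v" using pos by auto
  have "vnorm M (B *\<^sub>v v) \<le> sqrt q * vnorm M v"
    unfolding vnorm_def real_sqrt_mult[symmetric] using le[OF v(1)] by (rule real_sqrt_le_mono)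
  then show "vnorm M (B *\<^sub>v v) / vnorm M v \<le> sqrt q"
    using v(2) by (simp add: vnorm_def divide_le_eq)
qed

theorem theorem3p11:
  fixes b c \<beta> \<omega> \<eta> :: real
  assumes "b > 0" and "c > 0" and "\<beta> \<ge> 0"
    and "0 < \<omega>" and "\<omega> < 1"
    and "0 < \<eta>" and "\<eta> \<le> 2 * \<omega> * (1 - \<omega>)"
  shows "\<exists>h0 > 0. \<forall>J::nat. \<forall>N h \<delta> A D K T.
    J \<ge> 2 \<longrightarrow> N = 2^J - 1 \<longrightarrow> h = b / (real N + 1) \<longrightarrow> h < h0 \<longrightarrow>
    \<delta> = c * h powr \<beta> \<longrightarrow> \<delta> < b \<longrightarrow>
    A = stiffness_mat b N \<delta> \<longrightarrow> D = diag_part A \<longrightarrow>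
    K = damped_jacobi \<omega> A \<longrightarrow> T = coarse_correction J A \<longrightarrow>
      (\<forall>\<nu> \<in> carrier_vec N.
        (vnorm A (K *\<^sub>v \<nu>))^2 \<le> (vnorm A \<nu>)^2 - \<eta> * (vnorm (mat_inv D) (A *\<^sub>v \<nu>))^2) \<and>
      opnorm A (K * T) \<le> sqrt (1 - \<eta> / 6) \<and> sqrt (1 - \<eta> / 6) < 1"
proof (intro exI[of _ 1] conjI allI impI)
  \<comment> \<open>The estimates are uniform in \<open>h\<close> and \<open>R\<close>, which leaves
    the choice of the threshold free.\<close>
  show "(0::real) < 1" by simp
next
  fix J N :: nat and h \<delta> :: real and A D K T :: "real mat"
  assume J: "2 \<le> J" and N: "N = 2^J - 1" and h_def: "h = b / (real N + 1)"
    and \<delta>: "\<delta> = c * h powr \<beta>" and A: "A = stiffness_mat b N \<delta>" and D: "D = diag_part A"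
    and K: "K = damped_jacobi \<omega> A" and T: "T = coarse_correction J A"
  define R where "R = \<delta> / h"
  define d where "d = toeplitz_coeff h R 0"
  have h: "h > 0" using assms(1) by (simp add: h_def)
  then have R: "R > 0" using assms(2) by (simp add: R_def \<delta>)
  have A_eq: "A = mat N N (\<lambda>(i, j). toeplitz_coeff h R (nat \<bar>int i - int j\<bar>))"
    by (simp add: A stiffness_mat_def R_def h_def Let_def)
  have A_car: "A \<in> carrier_mat N N" by (simp add: A_eq)
  have sym: "transpose_mat A = A"
    unfolding A_eq by (rule eq_matI) (auto simp: abs_minus_commute)
  have d: "d > 0" unfolding d_def by (rule toeplitz_coeff_0_pos[OF h R])
  have diag: "A $$ (i, i) = d" if "i < N" for i using that by (simp add: A_eq d_def)
  note pos = stiffness_pos[OF h R A_eq]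
  have nonneg: "0 \<le> (A *\<^sub>v v) \<bullet> v" if "v \<in> carrier_vec N" for v
    using pos[OF that] that A_car by (cases "v = 0\<^sub>v N") auto
  have K_vec: "K *\<^sub>v v = v - (\<omega> / d) \<cdot>\<^sub>v (A *\<^sub>v v)" if "v \<in> carrier_vec N" for v
    unfolding K using d by (intro damped_jacobi_vec[OF A_car diag _ that]) auto
  have "mat_inv D = (1 / d) \<cdot>\<^sub>m 1\<^sub>m N"
    unfolding D using d by (intro mat_inv_diag_part_const[OF A_car diag]) auto
  then have D_norm: "(vnorm (mat_inv D) y)^2 = (y \<bullet> y) / d" if "y \<in> carrier_vec N" for y
    using that d scalar_prod_self_nonneg[of y]
    by (simp add: vnorm_def smult_mat_mult_vec[of _ N N])
  have K_car: "K \<in> carrier_mat N N"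
    using A_car \<open>mat_inv D = _\<close> by (auto simp: K damped_jacobi_def D)
  have smooth: "(A *\<^sub>v (K *\<^sub>v v)) \<bullet> (K *\<^sub>v v) \<le> (A *\<^sub>v v) \<bullet> v - \<eta> * (((A *\<^sub>v v) \<bullet> (A *\<^sub>v v)) / d)"
    if v: "v \<in> carrier_vec N" for v
  proof -
    let ?G = "(A *\<^sub>v v) \<bullet> (A *\<^sub>v v)"
    \<comment> \<open>Step length \<open>\<omega> / d\<close> and the bound \<open>L = 2 * d\<close>
      give the gain \<open>2 * \<omega> * (1 - \<omega>) / d\<close>, the source of the condition on
      \<open>\<eta>\<close>.\<close>
    have "(A *\<^sub>v (K *\<^sub>v v)) \<bullet> (K *\<^sub>v v)
        \<le> (A *\<^sub>v v) \<bullet> v - (2 * (\<omega> / d) - 2 * d * (\<omega> / d)^2) * ?G"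
      unfolding K_vec[OF v] d_def
      by (rule form_gradient_step[OF A_car sym v stiffness_le[OF h R A_eq]])
    also have "2 * (\<omega> / d) - 2 * d * (\<omega> / d)^2 = 2 * \<omega> * (1 - \<omega>) / d"
      using d by (simp add: field_simps power2_eq_square)
    also have "(A *\<^sub>v v) \<bullet> v - 2 * \<omega> * (1 - \<omega>) / d * ?G \<le> (A *\<^sub>v v) \<bullet> v - \<eta> / d * ?G"
      using assms(7) d scalar_prod_self_nonneg[of "A *\<^sub>v v"]
      by (intro diff_left_mono mult_right_mono divide_right_mono) auto
    finally show ?thesis by simp
  qed
  show "\<forall>\<nu> \<in> carrier_vec N.
      (vnorm A (K *\<^sub>v \<nu>))^2 \<le> (vnorm A \<nu>)^2 - \<eta> * (vnorm (mat_inv D) (A *\<^sub>v \<nu>))^2"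
  proof
    fix v :: "real vec" assume v: "v \<in> carrier_vec N"
    have "A *\<^sub>v v \<in> carrier_vec N" "K *\<^sub>v v \<in> carrier_vec N" using A_car K_car v by auto
    then show "(vnorm A (K *\<^sub>v v))^2 \<le> (vnorm A v)^2 - \<eta> * (vnorm (mat_inv D) (A *\<^sub>v v))^2"
      using smooth[OF v] nonneg v D_norm by (simp add: vnorm_def)
  qed
  \<comment> \<open>The resulting \<open>\<eta> \<le> 1 / 2\<close> gives both
    \<open>\<eta> \<le> 6\<close> and a non-negative radicand \<open>1 - \<eta> / 6\<close>.\<close>
  have "\<omega> * (1 - \<omega>) \<le> 1 / 4"
    using zero_le_power2[of "\<omega> - 1 / 2"] by (simp add: power2_eq_square algebra_simps)
  then have \<eta>: "\<eta> \<le> 1 / 2" using assms(7) by simp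
  have N_pos: "N > 0" using J power_increasing[of 2 J "2::nat"] by (simp add: N)
  show "opnorm A (K * T) \<le> sqrt (1 - \<eta> / 6)"
  proof (rule opnorm_le[OF _ N_pos])
    fix v :: "real vec" assume v: "v \<in> carrier_vec N"
    show "(A *\<^sub>v ((K * T) *\<^sub>v v)) \<bullet> ((K * T) *\<^sub>v v) \<le> (1 - \<eta> / 6) * ((A *\<^sub>v v) \<bullet> v)"
      unfolding T
    proof (rule two_grid_convergence[where d = d])
      show "\<exists>w \<in> carrier_vec (2^(J-1) - 1). d * ((u - prolongation J *\<^sub>v w) \<bullet> (u - prolongation J *\<^sub>v w))
          \<le> 6 * ((A *\<^sub>v u) \<bullet> u)" if "u \<in> carrier_vec (2^J - 1)" for u
        using stiffness_approximation[OF h R A_eq N, of u] that J by (simp add: d_def N)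
    qed (use J A_car sym pos v d assms(6) K_car smooth \<eta> N in auto)
  qed (use A_car pos \<eta> in auto)
  show "sqrt (1 - \<eta> / 6) < 1" using assms(6) by simp
qed

end
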